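(* Let $(A,\circ,[\cdot,\cdot])$ be an $n$-dimensional GD algebra over $\Bbbk$ and let $d:A\to A$ be a linear map which is a derivation of both $(A,[\cdot,\cdot])$ and $(A,\circ)$ and satisfies $d(x)\circ y=d(y)\circ x$ for all $x,y\in A$. On $\bar A:=A\oplus\langle h\rangle$ (with $\langle h\rangle$ one-dimensional), extend the operations of $A$ bilinearly by $[A,h]=0$, $x\circ h=0$, $h\circ x=d(x)$, $h\circ h=0$ for all $x\in A$ (the bracket being extended skew-symmetrically). Then $(\bar A,\circ,[\cdot,\cdot])$ is an $(n+1)$-dimensional GD algebra.
   Context: $\Bbbk$ is an algebraically closed field of characteristic $0$. A Novikov algebra is a vector space with a bilinear product $\circ$ satisfying $(x\circ y)\circ z-x\circ(y\circ z)=(y\circ x)\circ z-y\circ(x\circ z)$ and $(x\circ y)\circ z=(x\circ z)\circ y$. A Gelfand--Dorfman (GD) algebra is a triple $(A,\circ,[\cdot,\cdot])$ such that $(A,\circ)$ is a Novikov algebra, $(A,[\cdot,\cdot])$ is a Lie algebra, and for all $x,y,z\in A$: $[x,y\circ z]-[z,y\circ x]+[y,x]\circ z-[y,z]\circ x-y\circ[x,z]=0$. *)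

theory Defs
  imports "HOL-Computational_Algebra.Polynomial" "HOL-Analysis.Product_Vector"
begin

text \<open>
  A vector space over a field \<open>'k\<close> is the whole of a type \<open>'a :: ab_group_add\<close> together with a
  scalar multiplication satisfying the locale \<^locale>\<open>vector_space\<close>.
\<close>

locale bilinear_algebra = vector_space smul
  for smul :: "'k::field \<Rightarrow> 'a::ab_group_add \<Rightarrow> 'a" +
  fixes circ :: "'a \<Rightarrow> 'a \<Rightarrow> 'a"
  assumes linear_mult_right: "Vector_Spaces.linear smul smul (\<lambda>y. circ x y)"
    and linear_mult_left: "Vector_Spaces.linear smul smul (\<lambda>x. circ x y)"

locale novikov_algebra = bilinear_algebra smul circ
  for smul :: "'k::field \<Rightarrow> 'a::ab_group_add \<Rightarrow> 'a"
    and circ :: "'a \<Rightarrow> 'a \<Rightarrow> 'a"  (infixl \<open>\<odot>\<close> 70) +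
  assumes left_symmetric: "(x \<odot> y) \<odot> z - x \<odot> (y \<odot> z) = (y \<odot> x) \<odot> z - y \<odot> (x \<odot> z)"
    and right_commutative: "(x \<odot> y) \<odot> z = (x \<odot> z) \<odot> y"

locale lie_algebra = bilinear_algebra smul bracket
  for smul :: "'k::field \<Rightarrow> 'a::ab_group_add \<Rightarrow> 'a"
    and bracket :: "'a \<Rightarrow> 'a \<Rightarrow> 'a"  (\<open>\<lbrakk>_,/ _\<rbrakk>\<close>) +
  assumes alternating: "\<lbrakk>x, x\<rbrakk> = 0"
    and jacobi: "\<lbrakk>x, \<lbrakk>y, z\<rbrakk>\<rbrakk> + \<lbrakk>y, \<lbrakk>z, x\<rbrakk>\<rbrakk> + \<lbrakk>z, \<lbrakk>x, y\<rbrakk>\<rbrakk> = 0"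

locale gd_algebra = novikov_algebra smul circ + lie_algebra smul bracket
  for smul :: "'k::field \<Rightarrow> 'a::ab_group_add \<Rightarrow> 'a"
    and circ :: "'a \<Rightarrow> 'a \<Rightarrow> 'a"  (infixl \<open>\<odot>\<close> 70)
    and bracket :: "'a \<Rightarrow> 'a \<Rightarrow> 'a"  (\<open>\<lbrakk>_,/ _\<rbrakk>\<close>) +
  assumes compatible:
    "\<lbrakk>x, y \<odot> z\<rbrakk> - \<lbrakk>z, y \<odot> x\<rbrakk> + \<lbrakk>y, x\<rbrakk> \<odot> z - \<lbrakk>y, z\<rbrakk> \<odot> x - y \<odot> \<lbrakk>x, z\<rbrakk> = 0"

definition derivation ::
    "('k::field \<Rightarrow> 'a::ab_group_add \<Rightarrow> 'a) \<Rightarrow> ('a \<Rightarrow> 'a \<Rightarrow> 'a) \<Rightarrow> ('a \<Rightarrow> 'a) \<Rightarrow> bool" where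
  "derivation smul circ d \<longleftrightarrow>
     Vector_Spaces.linear smul smul d \<and>
     (\<forall>x y. d (circ x y) = circ (d x) y + circ x (d y))"

text \<open>
  The library function \<open>vector_space.dim\<close> returns \<open>0\<close> on infinite-dimensional spaces, so
  finite-dimensionality is required explicitly.
\<close>

definition has_dimension :: "('k::field \<Rightarrow> 'a::ab_group_add \<Rightarrow> 'a) \<Rightarrow> nat \<Rightarrow> bool" where
  "has_dimension smul n \<longleftrightarrow> (\<exists>B. finite_dimensional_vector_space smul B \<and> card B = n)"

text \<open>
  \<open>A \<oplus> \<langle>h\<rangle>\<close> is the product type \<open>'a \<times> 'k\<close>: the pair \<open>(x, a)\<close> stands for \<open>x + a h\<close>, so \<open>A\<close> consists
  of the pairs \<open>(x, 0)\<close> and \<open>h = (0, 1)\<close>.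
\<close>

definition ext_scale :: "('k::field \<Rightarrow> 'a::ab_group_add \<Rightarrow> 'a) \<Rightarrow> 'k \<Rightarrow> 'a \<times> 'k \<Rightarrow> 'a \<times> 'k" where
  "ext_scale smul = module_prod.scale smul (*)"

text \<open>
  Bilinear expansion of \<open>(x + a h) \<circ> (y + b h)\<close> with \<open>x \<circ> h = 0\<close>, \<open>h \<circ> y = d y\<close>, \<open>h \<circ> h = 0\<close>, and of
  \<open>[x + a h, y + b h]\<close> with \<open>[x, h] = [h, y] = [h, h] = 0\<close>. The lemmas below characterize
  the two operations by these values.
\<close>

definition ext_mult ::
    "('k::field \<Rightarrow> 'a::ab_group_add \<Rightarrow> 'a) \<Rightarrow> ('a \<Rightarrow> 'a \<Rightarrow> 'a) \<Rightarrow> ('a \<Rightarrow> 'a) \<Rightarrow>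
     'a \<times> 'k \<Rightarrow> 'a \<times> 'k \<Rightarrow> 'a \<times> 'k" where
  "ext_mult smul circ d = (\<lambda>(x, a) (y, b). (circ x y + smul a (d y), 0))"

definition ext_bracket ::
    "('a::ab_group_add \<Rightarrow> 'a \<Rightarrow> 'a) \<Rightarrow> 'a \<times> 'k::field \<Rightarrow> 'a \<times> 'k \<Rightarrow> 'a \<times> 'k" where
  "ext_bracket bracket = (\<lambda>(x, a) (y, b). (bracket x y, 0))"

lemma vector_space_times: "vector_space ((*) :: 'k::field \<Rightarrow> 'k \<Rightarrow> 'k)"
  by unfold_locales (auto simp: algebra_simps)

lemma vector_space_prod_ext: "vector_space smul \<Longrightarrow> vector_space_prod smul ((*) :: 'k::field \<Rightarrow> _)"
  by (simp add: vector_space_prod_def vector_space_pair_def vector_space_times)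

lemma ext_scale_Pair:
  assumes "vector_space smul"
  shows "ext_scale smul c (x, a) = (smul c x, c * a)"
proof -
  interpret vector_space_prod smul "(*)"
    using assms by (rule vector_space_prod_ext)
  show ?thesis
    by (simp add: ext_scale_def scale_prod)
qed

lemma vector_space_ext_scale:
  assumes "vector_space smul"
  shows "vector_space (ext_scale smul)"
proof -
  interpret vector_space_prod smul "(*)"
    using assms by (rule vector_space_prod_ext)
  show ?thesis
    unfolding ext_scale_def by (rule p.vector_space_axioms)
qed

lemma bilinear_algebra_expand:
  fixes P :: "'a::ab_group_add \<times> 'k::field \<Rightarrow> 'a \<times> 'k \<Rightarrow> 'a \<times> 'k"
  assumes vs: "vector_space smul" and P: "bilinear_algebra (ext_scale smul) P"
  shows "P (x, a) (y, b) = P (x, 0) (y, 0) + ext_scale smul b (P (x, 0) (0, 1))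
    + ext_scale smul a (P (0, 1) (y, 0)) + ext_scale smul (a * b) (P (0, 1) (0, 1))"
proof -
  interpret vector_space smul by fact
  interpret P: bilinear_algebra "ext_scale smul" P by fact
  have decomp: "(z, c) = (z, 0) + ext_scale smul c (0, 1)" for z c
    by (simp add: ext_scale_Pair[OF vs])
  have L: "P (u + ext_scale smul c v) w = P u w + ext_scale smul c (P v w)" for u v w c
    using P.linear_mult_left[of w] by (simp add: Vector_Spaces.linear_iff del: split_paired_All)
  have R: "P w (u + ext_scale smul c v) = P w u + ext_scale smul c (P w v)" for u v w c
    using P.linear_mult_right[of w] by (simp add: Vector_Spaces.linear_iff del: split_paired_All)
  show ?thesis
    by (subst decomp[of x a], subst decomp[of y b])
      (simp only: L R P.scale_right_distrib P.scale_scale ac_simps)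
qed

lemma ext_mult_characterization:
  assumes A: "bilinear_algebra smul circ" and d: "Vector_Spaces.linear smul smul d"
  shows "P = ext_mult smul circ d \<longleftrightarrow>
    bilinear_algebra (ext_scale smul) P \<and>
    (\<forall>x y. P (x, 0) (y, 0) = (circ x y, 0)) \<and>
    (\<forall>x. P (x, 0) (0, 1) = 0) \<and> (\<forall>x. P (0, 1) (x, 0) = (d x, 0)) \<and> P (0, 1) (0, 1) = 0"
    (is "_ \<longleftrightarrow> ?R")
proof
  interpret A: bilinear_algebra smul circ by fact
  have vs: "vector_space smul" by unfold_locales
  have vse: "vector_space (ext_scale smul)" by (rule vector_space_ext_scale[OF vs])
  have add: "circ (x + x') y = circ x y + circ x' y" "circ x (y + y') = circ x y + circ x y'"
    "circ (smul c x) y = smul c (circ x y)" "circ x (smul c y) = smul c (circ x y)"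
    "d (x + y) = d x + d y" "d (smul c x) = smul c (d x)" for x x' y y' c
    using A.linear_mult_left[of y] A.linear_mult_right[of x] d
    by (simp_all add: Vector_Spaces.linear_iff)
  have zero: "circ 0 y = 0" "circ x 0 = 0" "d 0 = 0" for x y
    using add(1)[of 0 0 y] add(2)[of x 0 0] add(5)[of 0 0] by simp_all
  {
    assume "P = ext_mult smul circ d"
    then show ?R
      by (auto simp: bilinear_algebra_def bilinear_algebra_axioms_def Vector_Spaces.linear_iff vse
          ext_mult_def ext_scale_Pair[OF vs] add zero A.scale_left_distrib A.scale_right_distrib
          mult.commute zero_prod_def)
  next
    assume R: ?R
    show "P = ext_mult smul circ d"
      by (intro ext, clarify, subst bilinear_algebra_expand[OF vs])
        (use R in \<open>auto simp: ext_mult_def ext_scale_Pair[OF vs] zero_prod_def\<close>)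
  }
qed

lemma ext_bracket_characterization:
  fixes P :: "'a::ab_group_add \<times> 'k::field \<Rightarrow> 'a \<times> 'k \<Rightarrow> 'a \<times> 'k"
  assumes A: "lie_algebra smul bracket"
  shows "P = ext_bracket bracket \<longleftrightarrow>
    bilinear_algebra (ext_scale smul) P \<and> (\<forall>u. P u u = 0) \<and>
    (\<forall>x y. P (x, 0) (y, 0) = (bracket x y, 0)) \<and> (\<forall>x. P (x, 0) (0, 1) = 0)"
    (is "_ \<longleftrightarrow> ?R")
proof
  interpret A: lie_algebra smul bracket by fact
  have vs: "vector_space smul" by unfold_locales
  have vse: "vector_space (ext_scale smul)" by (rule vector_space_ext_scale[OF vs])
  have add: "bracket (x + x') y = bracket x y + bracket x' y"
    "bracket x (y + y') = bracket x y + bracket x y'"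
    "bracket (smul c x) y = smul c (bracket x y)"
    "bracket x (smul c y) = smul c (bracket x y)" for x x' y y' c
    using A.linear_mult_left[of y] A.linear_mult_right[of x]
    by (simp_all add: Vector_Spaces.linear_iff)
  have zero: "bracket 0 y = 0" "bracket x 0 = 0" for x y
    using add(1)[of 0 0 y] add(2)[of x 0 0] by simp_all
  {
    assume "P = ext_bracket bracket"
    then show ?R
      by (auto simp: bilinear_algebra_def bilinear_algebra_axioms_def Vector_Spaces.linear_iff vse
          ext_bracket_def ext_scale_Pair[OF vs] add zero A.alternating zero_prod_def)
  next
    assume R: ?R
    then interpret P: bilinear_algebra "ext_scale smul" P by blast
    have "P (u + v) (u + v) = P u u + P u v + P v u + P v v" for u v
      using P.linear_mult_left P.linear_mult_right
      by (simp add: Vector_Spaces.linear_iff algebra_simps del: split_paired_All)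
    with R have "P u v + P v u = 0" for u v
      by (simp del: split_paired_All)
    with R have "P (0, 1) (x, 0) = 0" for x
      by (metis add.left_neutral)
    with R show "P = ext_bracket bracket"
      by (intro ext, clarify, subst bilinear_algebra_expand[OF vs])
        (auto simp: ext_bracket_def ext_scale_Pair[OF vs] zero_prod_def)
  }
qed

end

theory Submission
  imports Defs "HOL-Analysis.Cartesian_Space"
begin

text \<open>
  Bilinearity of both extended products, and the fact that the extended bracket is alternating, are
  contained in their characterizations, so only the ternary identities and the dimension remain.
  Both products have values in \<open>A\<close>, hence evaluating a ternary identity at
  \<open>(x, a) = x + a h\<close>, \<open>(y, b) = y + b h\<close>, \<open>(z, c) = z + c h\<close> gives the same identity at \<open>x, y, z\<close>
  plus correction terms carrying a scalar \<open>a\<close> or \<open>b\<close>. Because \<open>d\<close> is a derivation of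
  \<open>\<circ>\<close>, the correction of the associator is \<open>- a (y \<circ> d z) - b (x \<circ> d z) - a b (d (d z))\<close>, which is
  symmetric under exchanging \<open>(x, a)\<close> and \<open>(y, b)\<close>: this is left symmetry. In right commutativity
  the correction is \<open>a (d y \<circ> z) - a (d z \<circ> y)\<close>, which is what the condition
  \<open>d y \<circ> z = d z \<circ> y\<close> kills. In the compatibility condition it is
  \<open>b ([x, d z] + [d x, z] - d [x, z])\<close>, which vanishes because \<open>d\<close> is a derivation of the bracket.
  The Jacobi identity acquires no correction, since \<open>h\<close> is central for the bracket.

  For the dimension, a basis of \<open>A\<close> together with \<open>h\<close> is a basis of \<open>A \<oplus> \<langle>h\<rangle>\<close>.
\<close>

lemma bilinear_algebra_rules:
  assumes "bilinear_algebra smul circ"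
  shows "circ (x + x') y = circ x y + circ x' y"
    and "circ x (y + y') = circ x y + circ x y'"
    and "circ (smul c x) y = smul c (circ x y)"
    and "circ x (smul c y) = smul c (circ x y)"
proof -
  interpret bilinear_algebra smul circ by fact
  show "circ (x + x') y = circ x y + circ x' y" "circ x (y + y') = circ x y + circ x y'"
    "circ (smul c x) y = smul c (circ x y)" "circ x (smul c y) = smul c (circ x y)"
    using linear_mult_left[of y] linear_mult_right[of x]
    by (simp_all add: Vector_Spaces.linear_iff)
qed

lemma derivation_rules:
  assumes "derivation smul circ d"
  shows "d (x + y) = d x + d y"
    and "d (smul c x) = smul c (d x)"
    and "d (circ x y) = circ (d x) y + circ x (d y)"
  using assms by (simp_all add: derivation_def Vector_Spaces.linear_iff)

lemma lie_algebra_antisymmetric: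
  assumes "lie_algebra smul bracket"
  shows "bracket y x = - bracket x y"
proof -
  interpret lie_algebra smul bracket by fact
  have "bracket (x + y) (x + y) = bracket x y + bracket y x"
    unfolding bilinear_algebra_rules(1,2)[OF bilinear_algebra_axioms]
    by (simp add: alternating)
  then have "bracket y x + bracket x y = 0"
    by (metis alternating add.commute)
  then show ?thesis
    by (simp add: eq_neg_iff_add_eq_0)
qed

text \<open>
  Left symmetry uses the derivation property of \<open>d\<close>, and right commutativity uses
  \<open>d x \<circ> y = d y \<circ> x\<close>.  The latter is forced: \<open>(h \<circ> x) \<circ> y = (h \<circ> y) \<circ> x\<close> is this very equation.
\<close>

lemma novikov_algebra_ext:
  assumes A: "novikov_algebra smul circ"
    and d: "derivation smul circ d"
    and comm: "\<And>x y. circ (d x) y = circ (d y) x"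
  shows "novikov_algebra (ext_scale smul) (ext_mult smul circ d)"
proof -
  interpret novikov_algebra smul circ by fact
  note bilin = bilinear_algebra_rules[OF bilinear_algebra_axioms]
  note der = derivation_rules[OF d]
  have "bilinear_algebra (ext_scale smul) (ext_mult smul circ d)"
    using ext_mult_characterization[OF bilinear_algebra_axioms] d
    unfolding derivation_def by blast
  moreover have "ext_mult smul circ d (ext_mult smul circ d u v) w
        - ext_mult smul circ d u (ext_mult smul circ d v w)
      = ext_mult smul circ d (ext_mult smul circ d v u) w
        - ext_mult smul circ d v (ext_mult smul circ d u w)" for u v w
  proof -
    obtain x a y b z c where uvw: "u = (x, a)" "v = (y, b)" "w = (z, c)"
      by (metis surj_pair)
    show ?thesis
      using left_symmetric[of x y z]
      by (simp add: uvw ext_mult_def bilin der scale_right_distrib mult.commute algebra_simps)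
  qed
  moreover have "ext_mult smul circ d (ext_mult smul circ d u v) w
      = ext_mult smul circ d (ext_mult smul circ d u w) v" for u v w
  proof -
    obtain x a y b z c where uvw: "u = (x, a)" "v = (y, b)" "w = (z, c)"
      by (metis surj_pair)
    show ?thesis
      using right_commutative[of x y z] comm[of y z]
      by (simp add: uvw ext_mult_def bilin)
  qed
  ultimately show ?thesis
    by (simp add: novikov_algebra_def novikov_algebra_axioms_def del: split_paired_All)
qed

lemma lie_algebra_ext:
  fixes smul :: "'k::field \<Rightarrow> 'a::ab_group_add \<Rightarrow> 'a"
  assumes A: "lie_algebra smul bracket"
  shows "lie_algebra (ext_scale smul) (ext_bracket bracket :: 'a \<times> 'k \<Rightarrow> 'a \<times> 'k \<Rightarrow> 'a \<times> 'k)"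
proof -
  interpret lie_algebra smul bracket by fact
  have "bilinear_algebra (ext_scale smul)
      (ext_bracket bracket :: 'a \<times> 'k \<Rightarrow> 'a \<times> 'k \<Rightarrow> 'a \<times> 'k)"
    using ext_bracket_characterization[OF A] by blast
  then show ?thesis
    by (auto simp: lie_algebra_def lie_algebra_axioms_def ext_bracket_def alternating jacobi
        zero_prod_def)
qed

text \<open>
  In the compatibility condition every left factor of \<open>\<circ>\<close> is the middle argument or a bracket.
  As \<open>h\<close> acts nontrivially only from the left and brackets have no \<open>h\<close> component, the only
  component along \<open>h\<close> that contributes is that of the middle argument, and its coefficient measures
  the failure of \<open>d\<close> to be a derivation of the bracket.
\<close>

lemma gd_algebra_ext:
  fixes smul :: "'k::field \<Rightarrow> 'a::ab_group_add \<Rightarrow> 'a"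
  assumes A: "gd_algebra smul circ bracket"
    and d_bracket: "derivation smul bracket d"
    and d_circ: "derivation smul circ d"
    and comm: "\<And>x y. circ (d x) y = circ (d y) x"
  shows "gd_algebra (ext_scale smul) (ext_mult smul circ d)
    (ext_bracket bracket :: 'a \<times> 'k \<Rightarrow> 'a \<times> 'k \<Rightarrow> 'a \<times> 'k)"
proof -
  interpret gd_algebra smul circ bracket by fact
  let ?m = "ext_mult smul circ d"
  let ?b = "ext_bracket bracket :: 'a \<times> 'k \<Rightarrow> 'a \<times> 'k \<Rightarrow> 'a \<times> 'k"
  have lie: "lie_algebra smul bracket" by unfold_locales
  have novikov: "novikov_algebra smul circ" by unfold_locales
  note bilin = bilinear_algebra_rules[OF lie_algebra.axioms(1)[OF lie]]
  have "?b u (?m v w) - ?b w (?m v u) + ?m (?b v u) w - ?m (?b v w) u - ?m v (?b u w) = 0"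
    for u v w
  proof -
    obtain x a y b z c where uvw: "u = (x, a)" "v = (y, b)" "w = (z, c)"
      by (metis surj_pair)
    have "bracket x (circ y z + smul b (d z)) - bracket z (circ y x + smul b (d x))
        + circ (bracket y x) z - circ (bracket y z) x
        - (circ y (bracket x z) + smul b (d (bracket x z)))
      = smul b (bracket x (d z) + bracket (d x) z - d (bracket x z))"
      using compatible[of x y z] lie_algebra_antisymmetric[OF lie, of z "d x"]
      by (simp add: bilin scale_right_distrib scale_right_diff_distrib algebra_simps)
    also have "\<dots> = 0"
      by (simp add: derivation_rules[OF d_bracket])
    finally show ?thesis
      by (simp add: uvw ext_mult_def ext_bracket_def zero_prod_def)
  qed
  then show ?thesis
    using novikov_algebra_ext[OF novikov d_circ comm] lie_algebra_ext[OF lie]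
    by (simp add: gd_algebra_def gd_algebra_axioms_def del: split_paired_All)
qed

lemma has_dimension_ext_scale:
  fixes smul :: "'k::field \<Rightarrow> 'a::ab_group_add \<Rightarrow> 'a"
  assumes "has_dimension smul n"
  shows "has_dimension (ext_scale smul) (n + 1)"
proof -
  obtain B where "finite_dimensional_vector_space smul B" and card: "card B = n"
    using assms by (auto simp: has_dimension_def)
  then interpret A: finite_dimensional_vector_space smul B by simp
  interpret P: finite_dimensional_vector_space_prod smul "(*)" B "{1::'k}"
    by unfold_locales
  have "card P.Basis_pair = card (B \<times> {0::'k}) + card ({0::'a} \<times> {1::'k})"
    unfolding P.Basis_pair_def by (rule card_Un_disjoint) (auto simp: A.finite_Basis)
  then have "card P.Basis_pair = n + 1"
    by (simp add: card card_cartesian_product)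
  moreover have "finite_dimensional_vector_space (ext_scale smul) P.Basis_pair"
    unfolding ext_scale_def by (rule P.p.finite_dimensional_vector_space_axioms)
  ultimately show ?thesis
    unfolding has_dimension_def by blast
qed

theorem proposition5p5:
  fixes smul :: "'k::{alg_closed_field, field_char_0} \<Rightarrow> 'a::ab_group_add \<Rightarrow> 'a"
    and circ bracket :: "'a \<Rightarrow> 'a \<Rightarrow> 'a"
    and d :: "'a \<Rightarrow> 'a"
    and n :: nat
  assumes "gd_algebra smul circ bracket"
    and "has_dimension smul n"
    and "derivation smul bracket d"
    and "derivation smul circ d"
    and "\<And>x y. circ (d x) y = circ (d y) x"
  shows "gd_algebra (ext_scale smul) (ext_mult smul circ d)
           (ext_bracket bracket :: 'a \<times> 'k \<Rightarrow> 'a \<times> 'k \<Rightarrow> 'a \<times> 'k)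
         \<and> has_dimension (ext_scale smul) (n + 1)"
  using gd_algebra_ext[OF assms(1,3-5)] has_dimension_ext_scale[OF assms(2)] by blast

end
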